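(* Let $d\ge 1$ be an integer and let $\mathcal{A}=\mathcal{M}(2d,\mathbb{R})$ be the real algebra of real $2d\times 2d$ matrices. Then the set $\{f\in\mathcal{A} : f^2=-\mathbf{1}\}$ of square roots of $-\mathbf{1}$ is a single conjugacy class. It is a submanifold of $\mathcal{A}$ with exactly two connected components (the same number as the group $\mathrm{G}(\mathcal{A})$ of invertible elements), of dimension $2d^2=\dim_{\mathbb{R}}(\mathcal{A})/2$, and it is contained in the hyperplane $\{f : \mathrm{Scal}(f)=0\}$.
   Context: $\mathbf{1}$ is the unit matrix. The conjugacy class of $f\in\mathcal{A}$ is $\{a^{-1}fa : a\in \mathrm{G}(\mathcal{A})\}$. $\mathcal{A}$ carries its usual topology as a finite-dimensional real vector space. The center of $\mathcal{A}$ is $\mathrm{Z}(\mathcal{A})=\mathbb{R}\mathbf{1}$, and $\mathcal{A}=\mathrm{Z}(\mathcal{A})\oplus[\mathcal{A},\mathcal{A}]$, where $[\mathcal{A},\mathcal{A}]$ is the span of all commutators $fg-gf$. The linear form $\mathrm{Scal}:\mathcal{A}\to\mathbb{R}$ is defined by: $\mathrm{Scal}(f)\mathbf{1}$ is the projection of $f$ onto $\mathrm{Z}(\mathcal{A})$ along $[\mathcal{A},\mathcal{A}]$ (so $\mathrm{tr}(f)=2d\,\mathrm{Scal}(f)$). *)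

theory Defs
  imports "HOL-Analysis.Analysis"
begin

text \<open>In finite dimension, being $C^k$ on an open set can be tested on directional
  derivatives; this avoids recursion through the types of iterated Frechet derivatives.\<close>

fun C_k_on :: "nat \<Rightarrow> ('a::euclidean_space \<Rightarrow> 'b::euclidean_space) \<Rightarrow> 'a set \<Rightarrow> bool" where
  "C_k_on 0 f U \<longleftrightarrow> continuous_on U f"
| "C_k_on (Suc k) f U \<longleftrightarrow>
     (\<forall>x\<in>U. f differentiable (at x)) \<and>
     (\<forall>v. C_k_on k (\<lambda>x. frechet_derivative f (at x) v) U)"

definition smooth_on :: "('a::euclidean_space \<Rightarrow> 'b::euclidean_space) \<Rightarrow> 'a set \<Rightarrow> bool" where
  "smooth_on f U \<longleftrightarrow> (\<forall>k. C_k_on k f U)"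

text \<open>Embedded smooth submanifold of pure dimension \<open>k\<close> (without boundary): around every point
  some ambient diffeomorphism straightens the set to a \<open>k\<close>-dimensional linear subspace.\<close>

definition submanifold :: "nat \<Rightarrow> 'a::euclidean_space set \<Rightarrow> bool" where
  "submanifold k S \<longleftrightarrow>
     (\<forall>p\<in>S. \<exists>U V \<phi> \<psi> L.
        open U \<and> p \<in> U \<and> open V \<and>
        homeomorphism U V \<phi> \<psi> \<and> smooth_on \<phi> U \<and> smooth_on \<psi> V \<and>
        subspace L \<and> dim L = k \<and> \<phi> ` (U \<inter> S) = V \<inter> (L :: 'a set))"

definition invertibles :: "(real^'n^'n) set" where
  "invertibles = {a. invertible a}"

definition conjugacy_class :: "real^'n^'n \<Rightarrow> (real^'n^'n) set" where
  "conjugacy_class f = {matrix_inv a ** f ** a | a. a \<in> invertibles}"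

definition sqrts_minus_one :: "(real^'n^'n) set" where
  "sqrts_minus_one = {f. f ** f = - mat 1}"

definition mat_center :: "(real^'n^'n) set" where
  "mat_center = {z. \<forall>f. z ** f = f ** z}"

definition commutator_space :: "(real^'n^'n) set" where
  "commutator_space = span {f ** g - g ** f | f g. True}"

definition Scal :: "real^'n^'n \<Rightarrow> real" where
  "Scal f = (THE c. c *\<^sub>R mat 1 \<in> (mat_center :: (real^'n^'n) set) \<and> f - c *\<^sub>R mat 1 \<in> commutator_space)"

text \<open>The description is well defined, by \<open>Scal_unique\<close> below.\<close>

lemma scaleR_mat_in_center: "c *\<^sub>R mat 1 \<in> (mat_center :: (real^'n^'n) set)"
  unfolding mat_center_def
  by (simp add: matrix_scalar_ac scalar_matrix_assoc[symmetric])

lemma trace_scaleR: "trace (c *\<^sub>R A) = c * trace (A :: real^'n^'n)"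
  by (simp add: trace_def sum_distrib_left)

lemma trace_commutator_space:
  assumes "f \<in> (commutator_space :: (real^'n^'n) set)"
  shows "trace f = 0"
  using assms unfolding commutator_space_def
proof (induction rule: span_induct_alt)
  case base
  then show ?case by (simp add: trace_def)
next
  case (step c x y)
  then show ?case
    by (auto simp: trace_add trace_sub trace_scaleR) (metis trace_mul_sym)
qed

definition mat_unit :: "'n \<Rightarrow> 'n \<Rightarrow> real^'n^'n" where
  "mat_unit i j = (\<chi> a b. if a = i \<and> b = j then 1 else 0)"

lemma mat_unit_mult:
  "mat_unit i j ** mat_unit k l = (if j = k then mat_unit i l else (0 :: real^'n^'n))"
proof -
  have "(\<Sum>m\<in>UNIV. (if a = i \<and> m = j then 1 else 0) * (if m = k \<and> b = l then 1 else 0))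
      = (if j = k \<and> a = i \<and> b = l then 1 else (0::real))" for a b
  proof -
    have "(\<Sum>m\<in>UNIV. (if a = i \<and> m = j then 1 else 0) * (if m = k \<and> b = l then 1 else 0))
       = (\<Sum>m\<in>UNIV. if m = j then (if j = k \<and> a = i \<and> b = l then 1 else 0) else (0::real))"
      by (rule sum.cong) auto
    then show ?thesis by simp
  qed
  then show ?thesis
    by (simp add: mat_unit_def matrix_matrix_mult_def vec_eq_iff)
qed

lemma mat_unit_in_commutator_space:
  "mat_unit i j - (if i = j then mat_unit k k else 0) \<in> (commutator_space :: (real^'n^'n) set)"
proof (cases "i = j")
  case True
  have "mat_unit i j - mat_unit k k = mat_unit i k ** mat_unit k i - mat_unit k i ** mat_unit i k"
    using True by (simp add: mat_unit_mult)
  then show ?thesis using True unfolding commutator_space_def by (auto intro!: span_base)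
next
  case False
  have "mat_unit i j = mat_unit i i ** mat_unit i j - mat_unit i j ** mat_unit i i"
    using False by (simp add: mat_unit_mult)
  then show ?thesis using False unfolding commutator_space_def
    by (simp, intro span_base) blast
qed

lemma mat_unit_expansion: "g = (\<Sum>i\<in>UNIV. \<Sum>j\<in>UNIV. g $ i $ j *\<^sub>R mat_unit i j)"
proof -
  have "(\<Sum>i\<in>UNIV. \<Sum>j\<in>UNIV. g $ i $ j * (if a = i \<and> b = j then 1 else 0)) = g $ a $ b" for a b
  proof -
    have "(\<Sum>i\<in>UNIV. \<Sum>j\<in>UNIV. g $ i $ j * (if a = i \<and> b = j then 1 else 0))
        = (\<Sum>i\<in>UNIV. if i = a then (\<Sum>j\<in>UNIV. if j = b then g $ i $ j else 0) else 0)"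
      by (rule sum.cong) (auto simp: if_distrib[of "(*) _"] cong: if_cong)
    then show ?thesis by simp
  qed
  then show ?thesis
    by (simp only: vec_eq_iff simp_thms sum_component vector_scaleR_component mat_unit_def vec_lambda_beta real_scaleR_def)
qed

lemma commutator_space_iff_trace: "f \<in> commutator_space \<longleftrightarrow> trace (f :: real^'n^'n) = 0"
proof
  assume tr: "trace f = 0"
  fix k :: 'n
  have "f = (\<Sum>i\<in>UNIV. \<Sum>j\<in>UNIV. f $ i $ j *\<^sub>R mat_unit i j) - trace f *\<^sub>R mat_unit k k"
    using tr mat_unit_expansion[of f] by simp
  also have "trace f *\<^sub>R mat_unit k k
      = (\<Sum>i\<in>UNIV. \<Sum>j\<in>UNIV. f $ i $ j *\<^sub>R (if i = j then mat_unit k k else 0))"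
    by (simp add: trace_def scaleR_sum_left if_distrib[of "(*\<^sub>R) _"] cong: if_cong)
  also have "(\<Sum>i\<in>UNIV. \<Sum>j\<in>UNIV. f $ i $ j *\<^sub>R mat_unit i j) - \<dots>
      = (\<Sum>i\<in>UNIV. \<Sum>j\<in>UNIV. f $ i $ j *\<^sub>R (mat_unit i j - (if i = j then mat_unit k k else 0)))"
    by (simp only: sum_subtractf scaleR_diff_right)
  also have "\<dots> \<in> commutator_space"
    using mat_unit_in_commutator_space unfolding commutator_space_def
    by (intro span_sum span_scale)
  finally show "f \<in> commutator_space" .
qed (rule trace_commutator_space)

lemma Scal_unique:
  "\<exists>!c. c *\<^sub>R mat 1 \<in> (mat_center :: (real^'n^'n) set) \<and> (f :: real^'n^'n) - c *\<^sub>R mat 1 \<in> commutator_space"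
  by (rule ex1I[of _ "trace f / CARD('n)"])
     (auto simp: scaleR_mat_in_center commutator_space_iff_trace trace_sub trace_scaleR trace_I field_simps)

lemma trace_eq_Scal: "trace (f :: real^'n^'n) = CARD('n) * Scal f"
  using theI'[OF Scal_unique[of f]] unfolding Scal_def[symmetric]
  by (simp add: commutator_space_iff_trace trace_sub trace_scaleR trace_I)

end

theory Submission
  imports Defs
begin

text \<open>For square roots \<open>f\<close>, \<open>g\<close> of \<open>-1\<close> and any \<open>x\<close>, the matrix \<open>a = x - f x g\<close> satisfies
  \<open>f a = a g\<close>; an intertwiner with minimal kernel is invertible, so all square roots are conjugate.
  Hence they form the orbit of a fixed \<open>J\<close> under the general linear group, whose two components are
  found by factoring invertible matrices into transvections. Matrices commuting with \<open>J\<close> have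
  positive determinant, so the orbits of the two components are disjoint. Around \<open>J\<close> the Cayley
  transform \<open>g \<mapsto> (g + J)\<^sup>-\<^sup>1 (g - J)\<close> straightens the set of square roots to the space of
  matrices anticommuting with \<open>J\<close>. An invertible such matrix (which exists since \<open>J\<close> and \<open>-J\<close> are
  conjugate) swaps that space with its complement, the centralizer of \<open>J\<close>.\<close>

section \<open>Smoothness of matrix inversion\<close>

lemma bounded_bilinear_matrix_mult:
  "bounded_bilinear ((**) :: real^'n^'m \<Rightarrow> real^'p^'n \<Rightarrow> real^'p^'m)"
  unfolding bilinear_conv_bounded_bilinear[symmetric] bilinear_def linear_iff
  by (simp add: matrix_matrix_mult_def vec_eq_iff algebra_simps sum.distrib sum_distrib_left)

interpretation mm: bounded_bilinear "(**) :: real^'n^'m \<Rightarrow> real^'p^'n \<Rightarrow> real^'p^'m"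
  by (rule bounded_bilinear_matrix_mult)

lemma continuous_on_det:
  fixes F :: "'a::topological_space \<Rightarrow> real^'n^'n"
  assumes "continuous_on S F"
  shows "continuous_on S (\<lambda>x. det (F x))"
  unfolding det_def by (intro continuous_intros assms)

lemma matrix_inv_mult:
  assumes "invertible (A :: real^'n^'n)"
  shows "A ** matrix_inv A = mat 1" "matrix_inv A ** A = mat 1"
  using someI_ex[OF assms[unfolded invertible_def]] by (auto simp: matrix_inv_def)

lemma matrix_inv_unique:
  assumes "(A :: real^'n^'n) ** B = mat 1"
  shows "matrix_inv A = B"
  by (metis assms invertible_right_inverse matrix_inv_mult(2) matrix_mul_assoc matrix_mul_lid matrix_mul_rid)

lemma open_invertible_preimage:
  fixes F :: "'a::topological_space \<Rightarrow> real^'n^'n"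
  assumes "continuous_on UNIV F"
  shows "open {x. invertible (F x)}"
  unfolding invertible_det_nz
  by (rule open_Collect_neq) (auto intro: continuous_on_det assms)

text \<open>Cramer's rule writes each entry of the inverse as a quotient of determinants, and these
  depend continuously on the matrix.\<close>

lemma continuous_on_matrix_inv:
  "continuous_on {A :: real^'n^'n. invertible A} matrix_inv"
proof -
  have *: "matrix_inv A = (\<chi> k j. det (\<chi> i l. if l = k then axis j 1 $ i else A$i$l) / det A)"
    if "invertible A" for A :: "real^'n^'n"
  proof -
    have "A *v column j (matrix_inv A) = axis j 1" for j
      using matrix_inv_mult(1)[OF that]
      by (metis matrix_vector_mul_assoc matrix_vector_mul_lid matrix_vector_mult_basis)
    then show ?thesis
      using cramer[of A] that
      by (simp add: invertible_det_nz vec_eq_iff column_def)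
  qed
  have entry: "continuous_on S (\<lambda>A :: real^'n^'n. if P then c else A$i$l)" for S P c i l
    by (cases P) (auto intro!: continuous_on_component continuous_on_id)
  show ?thesis
    by (subst continuous_on_cong[OF refl *])
       (auto simp: invertible_det_nz intro!: continuous_intros continuous_on_det
         continuous_on_vec_lambda entry)
qed

text \<open>The remainder is exactly
  \<open>(matrix_inv A - matrix_inv Y) ** (Y - A) ** matrix_inv A\<close>. Divided by the norm of
  \<open>Y - A\<close>, it tends to 0 by continuity of inversion.\<close>

lemma has_derivative_matrix_inv:
  fixes A :: "real^'n^'n"
  assumes "invertible A"
  shows "(matrix_inv has_derivative (\<lambda>h. - (matrix_inv A ** h ** matrix_inv A))) (at A)"
proof -
  obtain K where K: "0 < K" "\<And>(X :: real^'n^'n) (Y :: real^'n^'n). norm (X ** Y) \<le> norm X * norm Y * K"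
    using mm.pos_bounded by blast
  have op: "open {A :: real^'n^'n. invertible A}"
    by (rule open_invertible_preimage) (rule continuous_on_id)
  have cont: "(matrix_inv \<longlongrightarrow> matrix_inv A) (at A)"
    using continuous_on_eq_continuous_at[OF op] continuous_on_matrix_inv assms
    unfolding isCont_def by blast
  have lin: "bounded_linear (\<lambda>h. - (matrix_inv A ** h ** matrix_inv A))"
    by (intro bounded_linear_minus bounded_linear_compose[OF mm.bounded_linear_left mm.bounded_linear_right])
  have rem: "matrix_inv Y - matrix_inv A - - (matrix_inv A ** (Y - A) ** matrix_inv A)
      = (matrix_inv A - matrix_inv Y) ** (Y - A) ** matrix_inv A" if "invertible Y" for Y
  proof -
    have "matrix_inv Y ** A ** matrix_inv A = matrix_inv Y"
      by (simp add: matrix_inv_mult[OF assms] flip: matrix_mul_assoc)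
    moreover have "(matrix_inv A - matrix_inv Y) ** (Y - A) ** matrix_inv A
        = matrix_inv A ** Y ** matrix_inv A - matrix_inv A ** A ** matrix_inv A
          - matrix_inv Y ** Y ** matrix_inv A + matrix_inv Y ** A ** matrix_inv A"
      by (simp add: mm.diff_left mm.diff_right)
    ultimately show ?thesis
      by (simp add: mm.diff_left mm.diff_right matrix_inv_mult[OF that] matrix_inv_mult[OF assms])
  qed
  have "((\<lambda>Y. norm (matrix_inv Y - matrix_inv A - - (matrix_inv A ** (Y - A) ** matrix_inv A)) / norm (Y - A)) \<longlongrightarrow> 0) (at A)"
  proof (rule tendsto_sandwich[OF _ _ tendsto_const])
    show "((\<lambda>Y. norm (matrix_inv A - matrix_inv Y) * K * norm (matrix_inv A) * K) \<longlongrightarrow> 0) (at A)"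
      by (rule tendsto_eq_intros cont refl | simp)+
    show "\<forall>\<^sub>F Y in at A. norm (matrix_inv Y - matrix_inv A - - (matrix_inv A ** (Y - A) ** matrix_inv A)) / norm (Y - A)
        \<le> norm (matrix_inv A - matrix_inv Y) * K * norm (matrix_inv A) * K"
      unfolding eventually_at_topological
    proof (intro exI conjI ballI impI)
      fix Y assume "Y \<in> {A :: real^'n^'n. invertible A}" "Y \<noteq> A"
      have "norm ((matrix_inv A - matrix_inv Y) ** (Y - A) ** matrix_inv A)
          \<le> norm ((matrix_inv A - matrix_inv Y) ** (Y - A)) * norm (matrix_inv A) * K"
        by (rule K(2))
      also have "\<dots> \<le> (norm (matrix_inv A - matrix_inv Y) * norm (Y - A) * K) * norm (matrix_inv A) * K"
        using K by (intro mult_right_mono) auto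
      finally show "norm (matrix_inv Y - matrix_inv A - - (matrix_inv A ** (Y - A) ** matrix_inv A)) / norm (Y - A)
        \<le> norm (matrix_inv A - matrix_inv Y) * K * norm (matrix_inv A) * K"
        using \<open>Y \<noteq> A\<close> rem[of Y] \<open>Y \<in> _\<close> by (simp add: divide_le_eq mult_ac)
    qed (use op assms in auto)
  qed auto
  then show ?thesis
    using lin by (simp add: has_derivative_iff_norm)
qed

section \<open>Closure properties of C^k maps\<close>

lemma C_k_on_cong:
  assumes "open U" "\<And>x. x \<in> U \<Longrightarrow> f x = g x" "C_k_on k f U"
  shows "C_k_on k g U"
  using assms(2,3)
proof (induction k arbitrary: f g)
  case 0
  then show ?case using continuous_on_cong by force
next
  case (Suc k)
  have d: "f differentiable at x" if "x \<in> U" for x using Suc.prems that by simp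
  have fr: "frechet_derivative f (at x) = frechet_derivative g (at x)" if "x \<in> U" for x
    using frechet_derivative_transform_within_open[OF d assms(1)] that Suc.prems(1) by blast
  have "g differentiable at x" if "x \<in> U" for x
    using d[OF that] has_derivative_transform_within_open[OF _ assms(1) that, of f] Suc.prems(1)
    unfolding differentiable_def by blast
  moreover have "C_k_on k (\<lambda>x. frechet_derivative g (at x) v) U" for v
    by (rule Suc.IH[of "\<lambda>x. frechet_derivative f (at x) v"]) (use Suc.prems fr in auto)
  ultimately show ?case by simp
qed

text \<open>Lets the derivative be given by an explicit formula, which keeps the choice operator
  behind \<open>frechet_derivative\<close> out of the inductions below.\<close>

lemma C_k_on_Suc_I:
  assumes "open U" "\<And>x. x \<in> U \<Longrightarrow> (f has_derivative f' x) (at x)"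
    "\<And>v. C_k_on k (\<lambda>x. f' x v) U"
  shows "C_k_on (Suc k) f U"
proof -
  have "C_k_on k (\<lambda>x. frechet_derivative f (at x) v) U" for v
    by (rule C_k_on_cong[OF assms(1) _ assms(3)]) (use frechet_derivative_at[OF assms(2)] in simp)
  then show ?thesis using assms(2) by (auto simp: differentiable_def)
qed

lemma C_k_on_Suc_D:
  assumes "C_k_on (Suc k) f U"
  shows "C_k_on k f U"
  using assms
proof (induction k arbitrary: f)
  case 0
  then show ?case
    by (auto intro!: differentiable_imp_continuous_on simp: differentiable_on_def differentiable_at_withinI)
qed simp

lemma C_k_on_const: "open U \<Longrightarrow> C_k_on k (\<lambda>x. c) U"
proof (induction k arbitrary: c)
  case (Suc k)
  then show ?case by (intro C_k_on_Suc_I[where f'="\<lambda>_ _. 0"]) auto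
qed simp

lemma C_k_on_add:
  assumes "open U" "C_k_on k f U" "C_k_on k g U"
  shows "C_k_on k (\<lambda>x. f x + g x) U"
  using assms(2,3)
proof (induction k arbitrary: f g)
  case (Suc k)
  show ?case
    by (rule C_k_on_Suc_I[OF assms(1), where f'="\<lambda>x v. frechet_derivative f (at x) v + frechet_derivative g (at x) v"])
      (use Suc in \<open>auto intro!: has_derivative_add simp: frechet_derivative_works[symmetric]\<close>)
qed (auto intro: continuous_intros)

lemma C_k_on_matrix_mult:
  fixes f :: "'a::euclidean_space \<Rightarrow> real^'n^'m" and g :: "'a \<Rightarrow> real^'p^'n"
  assumes "open U" "C_k_on k f U" "C_k_on k g U"
  shows "C_k_on k (\<lambda>x. f x ** g x) U"
  using assms(2,3)
proof (induction k arbitrary: f g)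
  case (Suc k)
  have "C_k_on k f U" "C_k_on k g U"
    using Suc.prems by (auto intro: C_k_on_Suc_D simp del: C_k_on.simps)
  then show ?case
    by (intro C_k_on_Suc_I[OF assms(1), where
          f'="\<lambda>x v. f x ** frechet_derivative g (at x) v + frechet_derivative f (at x) v ** g x"])
      (use Suc in \<open>auto intro!: mm.FDERIV C_k_on_add[OF assms(1)] simp: frechet_derivative_works[symmetric]\<close>)
qed (auto intro: mm.continuous_on)

text \<open>Differentiating the inverse gives a product of two copies of it with a constant, so the
  induction on \<open>k\<close> closes under products. The affine argument serves both directions of
  the Cayley chart, with \<open>s = 1\<close> and \<open>s = -1\<close>.\<close>

lemma C_k_on_matrix_inv_affine:
  fixes B :: "real^'n^'n" and s :: real
  defines "U \<equiv> {X. invertible (s *\<^sub>R X + B)}"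
  shows "C_k_on k (\<lambda>X. matrix_inv (s *\<^sub>R X + B)) U"
proof -
  have op: "open U"
    unfolding U_def by (intro open_invertible_preimage continuous_intros)
  show ?thesis
  proof (induction k)
    case 0
    show ?case unfolding C_k_on.simps
      by (rule continuous_on_compose2[OF continuous_on_matrix_inv]) (auto simp: U_def intro!: continuous_intros)
  next
    case (Suc k)
    show ?case
    proof (rule C_k_on_Suc_I[OF op])
      fix X assume "X \<in> U"
      have "((\<lambda>X. s *\<^sub>R X + B) has_derivative (\<lambda>v. s *\<^sub>R v)) (at X)"
        by (auto intro!: derivative_eq_intros)
      from has_derivative_compose[OF this has_derivative_matrix_inv] \<open>X \<in> U\<close>
      show "((\<lambda>X. matrix_inv (s *\<^sub>R X + B)) has_derivative
          (\<lambda>v. (matrix_inv (s *\<^sub>R X + B) ** ((- s) *\<^sub>R v)) ** matrix_inv (s *\<^sub>R X + B))) (at X)"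
        by (simp add: U_def mm.minus_left mm.minus_right)
    next
      fix v
      show "C_k_on k (\<lambda>X. (matrix_inv (s *\<^sub>R X + B) ** ((- s) *\<^sub>R v)) ** matrix_inv (s *\<^sub>R X + B)) U"
        by (intro C_k_on_matrix_mult C_k_on_const op Suc)
    qed
  qed
qed

section \<open>Intertwiners of square roots of minus one\<close>

definition rank_one :: "real^'n \<Rightarrow> real^'m \<Rightarrow> real^'m^'n" where
  "rank_one u w = (\<chi> i j. u$i * w$j)"

lemma rank_one_mult_vec: "rank_one u w *v x = (w \<bullet> x) *\<^sub>R u"
  by (simp add: rank_one_def matrix_vector_mult_def inner_vec_def vec_eq_iff sum_distrib_left mult_ac)

lemma invertible_iff_ker:
  "invertible (A :: real^'n^'n) \<longleftrightarrow> (\<forall>x. A *v x = 0 \<longrightarrow> x = 0)"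
  by (simp add: invertible_left_inverse matrix_left_invertible_ker)

lemma invertible_iff_surj:
  "invertible (A :: real^'n^'n) \<longleftrightarrow> surj ((*v) A)"
  by (simp add: invertible_right_inverse matrix_right_invertible_surjective)

lemma matrix_vector_mult_minus: "(- A) *v x = - (A *v (x :: real^'n))"
  using matrix_vector_mult_diff_rdistrib[of 0 A x] by simp

lemma invertible_intertwiner_exists:
  fixes f g :: "real^'n^'n"
  assumes f: "f ** f = - mat 1" and g: "g ** g = - mat 1"
  obtains a where "invertible a" "f ** a = a ** g"
proof -
  define kd where "kd a = dim {x. a *v x = 0}" for a :: "real^'n^'n"
  \<comment> \<open>The zero matrix is an intertwiner, so one with least kernel dimension
    exists.\<close>
  have "\<exists>a. f ** a = a ** g \<and> (\<forall>b. f ** b = b ** g \<longrightarrow> kd a \<le> kd b)"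
    by (rule ex_has_least_nat[of _ 0]) simp
  then obtain a where a: "f ** a = a ** g"
    and min: "\<And>b. f ** b = b ** g \<Longrightarrow> kd a \<le> kd b" by blast
  have "invertible a"
  proof (rule ccontr)
    assume ninv: "\<not> invertible a"
    then obtain v where v: "v \<noteq> 0" "a *v v = 0" using invertible_iff_ker by blast
    obtain w where w: "w \<notin> range ((*v) a)" using ninv invertible_iff_surj by blast
    \<comment> \<open>Averaging a rank-one map sending \<open>v\<close> to \<open>w\<close> gives an intertwiner \<open>b\<close> with image
      \<open>span {w, f w}\<close>, which meets the \<open>f\<close>-invariant image of \<open>a\<close> trivially; so \<open>a + b\<close> has a
      strictly smaller kernel.\<close>
    define r where "r = rank_one w v"
    define b where "b = r - f ** r ** g"
    have ffx: "f ** (f ** x) = - x" for x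
      by (simp add: matrix_mul_assoc f mm.minus_left)
    have ffv: "f *v (f *v x) = - x" for x
      by (simp add: matrix_vector_mul_assoc f matrix_vector_mult_minus)
    have "f ** b = b ** g"
      by (simp add: b_def mm.diff_left mm.diff_right ffx flip: matrix_mul_assoc)
        (simp add: g mm.minus_right)
    then have "f ** (a + b) = (a + b) ** g"
      using a by (simp add: mm.add_left mm.add_right)
    from min[OF this] have "kd a \<le> kd (a + b)" .
    have ker: "a *v u = 0 \<and> v \<bullet> u = 0" if u: "(a + b) *v u = 0" for u
    proof -
      define \<alpha> \<beta> where "\<alpha> = v \<bullet> u" and "\<beta> = v \<bullet> (g *v u)"
      have bu: "b *v u = \<alpha> *\<^sub>R w - \<beta> *\<^sub>R (f *v w)"
        by (simp add: b_def r_def matrix_vector_mult_diff_rdistrib \<alpha>_def \<beta>_def rank_one_mult_vec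
            matrix_vector_mult_scaleR flip: matrix_vector_mul_assoc)
      have au: "a *v u = \<beta> *\<^sub>R (f *v w) - \<alpha> *\<^sub>R w"
        using u bu by (simp add: matrix_vector_mult_add_rdistrib eq_neg_iff_add_eq_0 algebra_simps)
      have "a *v (g *v u) = f *v (a *v u)"
        by (simp add: a matrix_vector_mul_assoc)
      also have "\<dots> = - (\<beta> *\<^sub>R w) - \<alpha> *\<^sub>R (f *v w)"
        by (simp add: au matrix_vector_mult_diff_distrib matrix_vector_mult_scaleR ffv)
      finally have agu: "a *v (g *v u) = - (\<beta> *\<^sub>R w) - \<alpha> *\<^sub>R (f *v w)" .
      \<comment> \<open>In this combination the terms in \<open>f *v w\<close> cancel. If
        \<open>\<alpha>\<close> or \<open>\<beta>\<close> were nonzero, it would put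
        \<open>w\<close> into the image of \<open>a\<close>.\<close>
      have "a *v (- (\<alpha> *\<^sub>R u + \<beta> *\<^sub>R (g *v u))) = - (\<alpha> *\<^sub>R (a *v u) + \<beta> *\<^sub>R (a *v (g *v u)))"
        by (simp only: vec.neg vec.add matrix_vector_mult_scaleR)
      also have "\<dots> = (\<alpha>\<^sup>2 + \<beta>\<^sup>2) *\<^sub>R w"
        unfolding au agu by (simp add: power2_eq_square algebra_simps)
      finally have "a *v (- (\<alpha> *\<^sub>R u + \<beta> *\<^sub>R (g *v u))) = (\<alpha>\<^sup>2 + \<beta>\<^sup>2) *\<^sub>R w" .
      then have eq: "a *v (inverse (\<alpha>\<^sup>2 + \<beta>\<^sup>2) *\<^sub>R - (\<alpha> *\<^sub>R u + \<beta> *\<^sub>R (g *v u))) = w" if "\<alpha>\<^sup>2 + \<beta>\<^sup>2 \<noteq> 0"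
        using that by (simp add: matrix_vector_mult_scaleR)
      have "\<alpha>\<^sup>2 + \<beta>\<^sup>2 = 0" using eq w by (metis rangeI)
      then have "\<alpha> = 0" "\<beta> = 0" by (auto simp: sum_power2_eq_zero_iff)
      then show ?thesis using au \<alpha>_def by simp
    qed
    \<comment> \<open>Inclusion comes from \<open>ker\<close>, equality of dimensions from the
      minimality of \<open>a\<close>. The kernel vector \<open>v\<close> of \<open>a\<close> then
      satisfies \<open>v \<bullet> v = 0\<close>, which is absurd.\<close>
    have "{x. (a + b) *v x = 0} = {x. a *v x = 0}"
    proof (rule subspace_dim_equal)
      show "dim {x. a *v x = 0} \<le> dim {x. (a + b) *v x = 0}"
        using \<open>kd a \<le> kd (a + b)\<close> by (simp add: kd_def)
    qed (use ker in \<open>auto simp: subspace_def vec.add matrix_vector_mult_scaleR\<close>)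
    then have "(a + b) *v v = 0" using v by blast
    then show False using ker v by fastforce
  qed
  with a that show ?thesis by blast
qed

text \<open>Numbering the indices by \<open>0..<2*d\<close> pairs each even number with its
  successor. \<open>J\<close> is the permutation matrix of this pairing, with opposite signs on the
  two members of a pair.\<close>

lemma exists_sqrt_minus_one:
  assumes "CARD('n::finite) = 2 * d"
  shows "\<exists>J :: real^'n^'n. J ** J = - mat 1"
proof -
  obtain h where h: "bij_betw h (UNIV :: 'n set) {0..<2*d}"
    using ex_bij_betw_finite_nat[of "UNIV :: 'n set"] assms by auto
  define m where "m k = (if even k then k + 1 else k - 1)" for k :: nat
  have mm: "m (m k) = k" "even (m k) \<longleftrightarrow> odd k" for k by (auto simp: m_def)
  have mr: "m k < 2 * d" if "k < 2 * d" for k using that by (auto simp: m_def elim!: evenE)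
  define \<sigma> where "\<sigma> i = inv_into UNIV h (m (h i))" for i
  have hr: "h i < 2 * d" for i using h bij_betwE by fastforce
  have h\<sigma>: "h (\<sigma> i) = m (h i)" for i
    unfolding \<sigma>_def using h mr[OF hr[of i]] by (intro bij_betw_inv_into_right[OF h]) auto
  have \<sigma>\<sigma>: "\<sigma> (\<sigma> i) = i" for i
    using h by (metis (no_types, lifting) UNIV_I \<sigma>_def bij_betw_inv_into_left h\<sigma> mm(1))
  define s where "s i = (if even (h i) then -1 else 1 :: real)" for i
  have ss: "s i * s (\<sigma> i) = -1" for i by (simp add: s_def h\<sigma> mm)
  define J :: "real^'n^'n" where "J = (\<chi> i j. if j = \<sigma> i then s i else 0)"
  have "(\<Sum>k\<in>UNIV. (if k = \<sigma> i then s i else 0) * (if j = \<sigma> k then s k else 0)) = (if i = j then -1 else 0)" for i j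
  proof -
    have "(\<Sum>k\<in>UNIV. (if k = \<sigma> i then s i else 0) * (if j = \<sigma> k then s k else 0))
      = (\<Sum>k\<in>UNIV. if k = \<sigma> i then s i * (if j = \<sigma> k then s k else 0) else 0)"
      by (rule sum.cong) auto
    then show ?thesis using \<sigma>\<sigma> ss by auto
  qed
  then have "J ** J = - mat 1"
    by (simp add: J_def matrix_matrix_mult_def mat_def vec_eq_iff)
  then show ?thesis by blast
qed

section \<open>Determinants of matrices commuting with a complex structure\<close>

lemma det_affine_poly:
  fixes A B :: "'a::comm_ring_1^'n^'n"
  shows "\<exists>p. \<forall>z. poly p z = det (\<chi> i j. A$i$j + z * B$i$j)"
  by (rule exI[of _ "\<Sum>\<pi> | \<pi> permutes UNIV. [:of_int (sign \<pi>):] * (\<Prod>i\<in>UNIV. [:A$i$(\<pi> i), B$i$(\<pi> i):])"])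
    (simp add: det_def poly_sum poly_prod)

lemma connected_image_sign:
  fixes F :: "'a::topological_space \<Rightarrow> real"
  assumes "connected S" "continuous_on S F" "\<And>x. x \<in> S \<Longrightarrow> F x \<noteq> 0" "x \<in> S" "y \<in> S" "F x > 0"
  shows "F y > 0"
proof (rule ccontr)
  assume "\<not> F y > 0"
  then have "0 \<in> {F y..F x}" using assms by auto
  moreover have "{F y..F x} \<subseteq> F ` S"
    using assms by (intro connected_contains_Icc connected_continuous_image) auto
  ultimately have "0 \<in> F ` S" by blast
  then show False using assms(3) by force
qed

text \<open>Along \<open>z \<mapsto> det (1 + z (c - 1))\<close>, with complex \<open>z\<close> acting through \<open>J\<close>, one passes from
  \<open>1\<close> to \<open>det c\<close>. The zeros are among the roots of the complex polynomial \<open>det (1 + z (c - 1))\<close>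
  with honest complex scalars, because \<open>v \<mapsto> v - \<i> J v\<close> intertwines the two actions. Finitely many
  points do not disconnect the plane.\<close>

lemma det_pos_of_commute_sqrt_minus_one:
  fixes J c :: "real^'n^'n"
  assumes J: "J ** J = - mat 1" and c: "J ** c = c ** J" "invertible c"
  shows "det c > 0"
proof -
  define N where "N = c - mat 1"
  have JN: "J ** N = N ** J" using c by (simp add: N_def mm.diff_left mm.diff_right)
  define M where "M z = mat 1 + (Re z *\<^sub>R N + Im z *\<^sub>R (J ** N))" for z
  define NC :: "complex^'n^'n" where "NC = (\<chi> i j. of_real (N$i$j))"
  obtain p where p: "\<And>z. poly p z = det (\<chi> i j. (mat 1 :: complex^'n^'n)$i$j + z * NC$i$j)"
    using det_affine_poly[of "mat 1" NC] by blast
  have "poly p 0 = 1" by (simp add: p)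
  then have "finite {z. poly p z = 0}" by (metis poly_0 poly_roots_finite zero_neq_one)
  moreover have "{z. det (M z) = 0} \<subseteq> {z. poly p z = 0}"
  proof safe
    fix z assume "det (M z) = 0"
    then obtain v where v: "v \<noteq> 0" "M z *v v = 0"
      using invertible_det_nz invertible_iff_ker by blast
    define n where "n = N *v v"
    have Nv: "N *v (J *v v) = J *v n"
      by (simp add: n_def matrix_vector_mul_assoc JN)
    have e1: "v + (Re z *\<^sub>R n + Im z *\<^sub>R (J *v n)) = 0"
      using v(2) by (simp add: M_def n_def matrix_vector_mult_add_rdistrib matrix_vector_mul_assoc
          scaleR_matrix_vector_assoc)
    \<comment> \<open>\<open>e1\<close> and its image under \<open>J\<close> are, up to sign, the
      real and imaginary parts of the complex kernel equation for \<open>V\<close> below.\<close>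
    have "J *v (v + (Re z *\<^sub>R n + Im z *\<^sub>R (J *v n))) = 0"
      by (simp add: e1)
    then have e2: "J *v v + (Re z *\<^sub>R (J *v n) - Im z *\<^sub>R n) = 0"
      by (simp add: vec.add matrix_vector_mult_scaleR matrix_vector_mul_assoc J matrix_vector_mult_minus)
    \<comment> \<open>This is \<open>v - \<i> J v\<close>. Its real part \<open>v\<close> is
      nonzero, and \<open>NC\<close> maps it to \<open>n - \<i> J n\<close> because \<open>N\<close>
      commutes with \<open>J\<close>.\<close>
    define V :: "complex^'n" where "V = (\<chi> i. Complex (v$i) (- (J *v v)$i))"
    have "V \<noteq> 0" using v(1) by (auto simp: V_def vec_eq_iff complex_eq_iff)
    have NV: "(\<Sum>j\<in>UNIV. NC$i$j * V$j) = Complex (n$i) (- (J *v n)$i)" for i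
    proof -
      have "(\<Sum>j\<in>UNIV. NC$i$j * V$j)
          = Complex (\<Sum>j\<in>UNIV. N$i$j * v$j) (- (\<Sum>j\<in>UNIV. N$i$j * (J *v v)$j))"
        by (simp add: complex_eq_iff NC_def V_def sum_negf)
      then show ?thesis
        by (simp only: Nv[symmetric]) (simp add: n_def matrix_vector_mult_def)
    qed
    have "(\<chi> i j. (mat 1 :: complex^'n^'n)$i$j + z * NC$i$j) *v V = 0"
    proof -
      have "((\<chi> i j. (mat 1 :: complex^'n^'n)$i$j + z * NC$i$j) *v V)$i = 0" for i
      proof -
        have "((\<chi> i j. (mat 1 :: complex^'n^'n)$i$j + z * NC$i$j) *v V)$i
            = (mat 1 *v V)$i + z * (\<Sum>j\<in>UNIV. NC$i$j * V$j)"
          by (simp add: matrix_vector_mult_def sum.distrib sum_distrib_left algebra_simps)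
        also have "\<dots> = 0"
          using arg_cong[OF e1, of "\<lambda>x. x$i"] arg_cong[OF e2, of "\<lambda>x. x$i"]
          by (simp add: NV) (simp add: V_def complex_eq_iff algebra_simps)
        finally show ?thesis .
      qed
      then show ?thesis by (simp add: vec_eq_iff)
    qed
    then have "\<not> invertible (\<chi> i j. (mat 1 :: complex^'n^'n)$i$j + z * NC$i$j)"
      using \<open>V \<noteq> 0\<close> unfolding invertible_left_inverse matrix_left_invertible_ker by blast
    then show "poly p z = 0" unfolding p invertible_det_nz by blast
  qed
  ultimately have fin: "finite {z. det (M z) = 0}" by (rule rev_finite_subset)
  have conn: "connected (UNIV - {z. det (M z) = 0})"
    by (rule connected_open_delete_finite) (auto simp: fin)
  have c1: "M 1 = c" "M 0 = mat 1" by (auto simp: M_def N_def)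
  have "det (M 1) > 0"
  proof (rule connected_image_sign[OF conn, where F = "\<lambda>z. det (M z)" and x = 0 and y = 1])
    show "continuous_on (UNIV - {z. det (M z) = 0}) (\<lambda>z. det (M z))"
      unfolding M_def by (intro continuous_on_det continuous_intros)
  qed (use c c1 in \<open>auto simp: invertible_det_nz\<close>)
  then show ?thesis by (simp add: c1)
qed

section \<open>Components of the general linear group\<close>

text \<open>The number \<open>1 + w \<bullet> u\<close> is the determinant. Pairing the kernel
  equation of \<open>x\<close> with \<open>w\<close> shows that its product with
  \<open>w \<bullet> x\<close> vanishes.\<close>

lemma invertible_transvection:
  fixes u w :: "real^'n"
  assumes "1 + w \<bullet> u \<noteq> 0"
  shows "mat 1 + rank_one u w \<in> invertibles"
proof -
  have "x = 0" if "(mat 1 + rank_one u w) *v x = 0" for x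
  proof -
    have x: "x + (w \<bullet> x) *\<^sub>R u = 0"
      using that by (simp add: matrix_vector_mult_add_rdistrib rank_one_mult_vec)
    have "(w \<bullet> x) * (1 + w \<bullet> u) = w \<bullet> (x + (w \<bullet> x) *\<^sub>R u)"
      by (simp add: algebra_simps)
    then have "w \<bullet> x = 0" using assms by (simp add: x)
    then show ?thesis using x by simp
  qed
  then show ?thesis by (simp add: invertibles_def invertible_iff_ker)
qed

lemma connected_component_image:
  assumes "connected_component S x y" "continuous_on S f" "f ` S \<subseteq> T"
  shows "connected_component T (f x) (f y)"
proof -
  obtain C where C: "connected C" "C \<subseteq> S" "x \<in> C" "y \<in> C"
    using assms(1) unfolding connected_component_def by blast
  then have "connected (f ` C)"
    using assms(2) by (intro connected_continuous_image) (auto intro: continuous_on_subset)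
  then show ?thesis unfolding connected_component_def using C assms(3) by blast
qed

lemma connected_component_mult:
  assumes "connected_component invertibles x y" "b \<in> invertibles"
  shows "connected_component invertibles (x ** b) (y ** b)"
    and "connected_component invertibles (b ** x) (b ** y)"
  using assms(2) unfolding invertibles_def
  by (auto intro!: connected_component_image[OF assms(1)[unfolded invertibles_def]]
      mm.continuous_on continuous_intros invertible_mult)

lemma rank_one_linear:
  "rank_one (c *\<^sub>R u) w = c *\<^sub>R rank_one u w"
  "rank_one u (c *\<^sub>R w) = c *\<^sub>R rank_one u w"
  "rank_one u (w + w') = rank_one u w + rank_one u w'"
  by (simp_all add: rank_one_def vec_eq_iff algebra_simps)

text \<open>Scaling the rank-one part by \<open>t\<close> from 1 down to 0 keeps the determinant
  between \<open>1 + w \<bullet> u\<close> and 1, hence positive.\<close>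

lemma connected_component_transvection_one:
  fixes u w :: "real^'n"
  assumes "1 + w \<bullet> u > 0"
  shows "connected_component invertibles (mat 1 + rank_one u w) (mat 1)"
proof -
  let ?f = "\<lambda>t. mat 1 + t *\<^sub>R rank_one u w"
  have "?f t \<in> invertibles" if "t \<in> {0..1}" for t
  proof -
    have "1 + t * (w \<bullet> u) = (1 - t) + t * (1 + w \<bullet> u)" by (simp add: algebra_simps)
    also have "\<dots> > 0" using that assms by (cases "t = 0") (auto intro: add_nonneg_pos)
    finally show ?thesis using invertible_transvection[of w "t *\<^sub>R u"] by (simp add: rank_one_linear)
  qed
  moreover have "connected (?f ` {0..1})"
    by (intro connected_continuous_image continuous_intros) auto
  ultimately show ?thesis unfolding connected_component_def
    by (intro exI[of _ "?f ` {0..1}"]) (auto intro: image_eqI[of _ _ 1] image_eqI[of _ _ 0])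
qed

text \<open>The orthogonal reflection in the hyperplane perpendicular to \<open>u\<close>, written
  as a rank-one perturbation so that the results on these apply.\<close>

definition reflection :: "real^'n \<Rightarrow> real^'n^'n" where
  "reflection u = mat 1 + rank_one u ((- 2 / (u \<bullet> u)) *\<^sub>R u)"

text \<open>With \<open>u\<close> fixed, \<open>w\<close> moves along a segment to the covector of
  the reflection. The determinant stays a convex combination of \<open>1 + w \<bullet> u\<close> and
  -1, hence negative.\<close>

lemma connected_component_transvection_reflection:
  fixes u w :: "real^'n"
  assumes "1 + w \<bullet> u < 0"
  shows "connected_component invertibles (mat 1 + rank_one u w) (reflection u)"
proof -
  define w' where "w' = (- 2 / (u \<bullet> u)) *\<^sub>R u"
  have "u \<noteq> 0" using assms by auto
  then have w'u: "w' \<bullet> u = -2" by (simp add: w'_def)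
  let ?f = "\<lambda>t. mat 1 + ((1 - t) *\<^sub>R rank_one u w + t *\<^sub>R rank_one u w')"
  have "?f t \<in> invertibles" if "t \<in> {0..1}" for t
  proof -
    have "1 + ((1 - t) * (w \<bullet> u) + t * (w' \<bullet> u)) = (1 - t) * (1 + w \<bullet> u) + t * (-1)"
      by (simp add: w'u algebra_simps)
    also have "\<dots> < 0"
    proof (cases "t = 0")
      case False
      then show ?thesis using that assms mult_nonneg_nonpos[of "1 - t" "1 + w \<bullet> u"] by simp
    qed (use assms in simp)
    finally show ?thesis
      using invertible_transvection[of "(1 - t) *\<^sub>R w + t *\<^sub>R w'" u]
      by (simp add: rank_one_linear inner_add_left)
  qed
  moreover have "connected (?f ` {0..1})"
    by (intro connected_continuous_image continuous_intros) auto
  ultimately show ?thesis unfolding connected_component_def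
    by (intro exI[of _ "?f ` {0..1}"])
      (auto simp: reflection_def w'_def intro: image_eqI[of _ _ 1] image_eqI[of _ _ 0])
qed

lemma reflection_invertible: "u \<noteq> 0 \<Longrightarrow> reflection u \<in> invertibles"
  unfolding reflection_def by (rule invertible_transvection) simp

text \<open>From dimension 2 on, the punctured space is connected, and the reflection depends
  continuously on its nonzero vector.\<close>

lemma connected_component_reflections:
  fixes u v :: "real^'n"
  assumes "u \<noteq> 0" "v \<noteq> 0" "CARD('n) \<ge> 2"
  shows "connected_component invertibles (reflection u) (reflection v)"
proof -
  have "connected (- {0 :: real^'n})"
    by (rule connected_punctured_universe) (use assms in simp)
  moreover have "continuous_on (- {0 :: real^'n}) reflection"
    unfolding reflection_def rank_one_def
    by (auto intro!: continuous_intros continuous_on_vec_lambda)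
  ultimately have "connected (reflection ` (- {0 :: real^'n}))"
    by (rule connected_continuous_image[rotated])
  then show ?thesis unfolding connected_component_def
    using assms reflection_invertible by blast
qed

lemma reflection_axis:
  "reflection (axis k 1 :: real^'n) = (\<chi> i j. if i = j then (if i = k then - 1 else 1) else 0)"
proof -
  have "axis k 1 \<bullet> axis k (1::real) = 1" by (simp add: inner_axis_axis)
  then show ?thesis by (auto simp: reflection_def rank_one_def mat_def vec_eq_iff axis_def)
qed

lemma det_reflection_axis: "det (reflection (axis k 1 :: real^'n)) = -1"
  unfolding reflection_axis by (subst det_diagonal) auto

lemma reflection_axis_involution:
  "reflection (axis k 1 :: real^'n) ** reflection (axis k 1) = mat 1"
proof -
  let ?R = "reflection (axis k 1 :: real^'n)"
  have "?R *v (?R *v x) = x" for x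
  proof -
    have "?R *v y = (\<chi> i. (if i = k then - 1 else 1) * y$i)" for y
      unfolding reflection_axis
      by (simp add: matrix_vector_mult_def vec_eq_iff if_distrib[of "\<lambda>x. x * _"] cong: if_cong)
    then show ?thesis by (simp add: vec_eq_iff)
  qed
  then show ?thesis by (simp add: matrix_eq matrix_vector_mul_assoc)
qed

text \<open>For a vector \<open>v\<close> moved by \<open>a\<close>, the transvection is chosen to
  send \<open>a *v v\<close> back to \<open>v\<close> while fixing every vector fixed by
  \<open>a\<close>. This needs \<open>w\<close> orthogonal to the fixed space but neither to
  \<open>v\<close> nor to \<open>a *v v\<close>.\<close>

lemma exists_fixing_transvection:
  fixes a :: "real^'n^'n"
  assumes a: "invertible a" and "a \<noteq> mat 1"
  obtains u w where "1 + w \<bullet> u \<noteq> 0"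
    "{v. a *v v = v} \<subset> {v. ((mat 1 + rank_one u w) ** a) *v v = v}"
proof -
  define K where "K = {v. a *v v = v}"
  have sub: "subspace K"
    by (auto simp: K_def subspace_def vec.add matrix_vector_mult_scaleR)
  obtain v where v: "a *v v \<noteq> v"
    using assms(2) by (metis matrix_eq matrix_vector_mul_lid)
  have inj: "x = y" if "a *v x = a *v y" for x y
    using a that by (metis invertible_left_inverse matrix_vector_mul_assoc matrix_vector_mul_lid)
  have vK: "v \<notin> K" "a *v v \<notin> K" using v inj[of "a *v v" v] by (auto simp: K_def)
  obtain y p where v_dec: "y \<in> K" "\<And>k. k \<in> K \<Longrightarrow> orthogonal p k" "v = y + p"
    using orthogonal_subspace_decomp_exists[of K v] span_eq_iff[of K] sub by metis
  obtain y' q where av_dec: "y' \<in> K" "\<And>k. k \<in> K \<Longrightarrow> orthogonal q k" "a *v v = y' + q"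
    using orthogonal_subspace_decomp_exists[of K "a *v v"] span_eq_iff[of K] sub by metis
  have pq: "p \<noteq> 0" "q \<noteq> 0" using v_dec av_dec vK by auto
  \<comment> \<open>Orthogonal \<open>p\<close> and \<open>q\<close> both pair with
    \<open>p + q\<close> to their squared norms; otherwise \<open>p\<close> alone pairs nontrivially
    with both.\<close>
  define w where "w = (if p \<bullet> q = 0 then p + q else p)"
  have wK: "w \<bullet> k = 0" if "k \<in> K" for k
    using v_dec(2)[OF that] av_dec(2)[OF that] by (auto simp: w_def orthogonal_def inner_add_left)
  have wv: "w \<bullet> v \<noteq> 0"
    unfolding v_dec(3) inner_add_right wK[OF v_dec(1)] using pq
    by (auto simp: w_def inner_add_left inner_add_right inner_commute)
  have wav: "w \<bullet> (a *v v) \<noteq> 0"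
    unfolding av_dec(3) inner_add_right wK[OF av_dec(1)] using pq
    by (auto simp: w_def inner_add_left inner_add_right inner_commute)
  \<comment> \<open>The factor makes \<open>a *v v\<close> go to \<open>v\<close>; then
    \<open>1 + w \<bullet> u\<close> is the quotient of \<open>w \<bullet> v\<close> by
    \<open>w \<bullet> (a *v v)\<close>.\<close>
  define u where "u = (1 / (w \<bullet> (a *v v))) *\<^sub>R (v - a *v v)"
  have act: "((mat 1 + rank_one u w) ** a) *v x = a *v x + (w \<bullet> (a *v x)) *\<^sub>R u" for x
    by (simp add: matrix_vector_mult_add_rdistrib rank_one_mult_vec flip: matrix_vector_mul_assoc)
  show ?thesis
  proof
    show "1 + w \<bullet> u \<noteq> 0" using wv wav by (simp add: u_def inner_diff_right field_simps)
    have "((mat 1 + rank_one u w) ** a) *v v = v"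
      unfolding act using wav by (simp add: u_def)
    moreover have "((mat 1 + rank_one u w) ** a) *v k = k" if "k \<in> K" for k
      unfolding act using wK[OF that] that by (simp add: K_def)
    ultimately show "{v. a *v v = v} \<subset> {v. ((mat 1 + rank_one u w) ** a) *v v = v}"
      using v by (auto simp: K_def)
  qed
qed

text \<open>Induction on the codimension of the fixed space, which shrinks under multiplication by a
  suitable transvection. Here \<open>undefined\<close> just picks some coordinate axis.\<close>

lemma invertible_connected_component_one_or_reflection:
  fixes a :: "real^'n^'n"
  assumes "CARD('n) \<ge> 2" "a \<in> invertibles"
  defines "R \<equiv> reflection (axis undefined 1) :: real^'n^'n"
  shows "\<exists>x\<in>{mat 1, R}. connected_component invertibles a x"
  using assms(2)
proof (induction "CARD('n) - dim {v. a *v v = v}" arbitrary: a rule: less_induct)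
  case less
  have RR: "R ** R = mat 1" unfolding R_def by (rule reflection_axis_involution)
  have inv: "mat 1 \<in> (invertibles :: (real^'n^'n) set)" "R \<in> invertibles"
    by (simp_all add: R_def invertibles_def invertible_det_nz det_reflection_axis)
  show ?case
  proof (cases "a = mat 1")
    case True
    then have "connected_component invertibles a (mat 1)" using inv by simp
    then show ?thesis by blast
  next
    case False
    have "invertible a" using less.prems by (simp add: invertibles_def)
    obtain u w where uw: "1 + w \<bullet> u \<noteq> 0"
      "{v. a *v v = v} \<subset> {v. ((mat 1 + rank_one u w) ** a) *v v = v}"
      by (rule exists_fixing_transvection[OF \<open>invertible a\<close> False])
    \<comment> \<open>Only transvections with negative determinant leave the component of \<open>1\<close>, and those lie in
      that of the involution \<open>R\<close>.\<close>
    define \<tau> where "\<tau> = mat 1 + rank_one u w"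
    have \<tau>: "\<tau> \<in> invertibles" unfolding \<tau>_def by (rule invertible_transvection) fact
    have sub: "subspace {v. b *v v = v}" for b :: "real^'n^'n"
      by (auto simp: subspace_def vec.add matrix_vector_mult_scaleR)
    have "dim {v. a *v v = v} < dim {v. (\<tau> ** a) *v v = v}"
      using uw(2) by (intro dim_psubset) (simp add: \<tau>_def span_eq_iff[THEN iffD2, OF sub])
    moreover have "dim {v. (\<tau> ** a) *v v = v} \<le> CARD('n)"
      using dim_subset_UNIV[of "{v. (\<tau> ** a) *v v = v}"] by simp
    ultimately have "CARD('n) - dim {v. (\<tau> ** a) *v v = v} < CARD('n) - dim {v. a *v v = v}"
      by linarith
    moreover have "\<tau> ** a \<in> invertibles"
      using \<tau> less.prems by (auto simp: invertibles_def intro: invertible_mult)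
    ultimately obtain x where x: "x \<in> {mat 1, R}" "connected_component invertibles (\<tau> ** a) x"
      using less.hyps by blast
    obtain y where y: "y \<in> {mat 1, R}" "connected_component invertibles \<tau> y"
    proof (cases "1 + w \<bullet> u > 0")
      case True
      then show ?thesis using that connected_component_transvection_one \<tau>_def by blast
    next
      case False
      then have "1 + w \<bullet> u < 0" using uw by simp
      moreover from this have "u \<noteq> 0" by auto
      ultimately have "connected_component invertibles \<tau> R"
        unfolding \<tau>_def R_def using assms(1)
        by (intro connected_component_trans[OF connected_component_transvection_reflection
              connected_component_reflections]) auto
      then show ?thesis using that by blast
    qed
    have yy: "y ** y = mat 1" "y \<in> invertibles" using y RR inv by auto
    \<comment> \<open>Since \<open>y\<close> is its own inverse, moving \<open>\<tau>\<close> to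
      \<open>y\<close> leads from \<open>y ** (\<tau> ** a)\<close> to \<open>a\<close>, while
      moving \<open>\<tau> ** a\<close> to \<open>x\<close> leads to \<open>y ** x\<close>.\<close>
    have "connected_component invertibles (y ** (\<tau> ** a)) (y ** (y ** a))"
      by (intro connected_component_mult y less.prems yy)
    then have "connected_component invertibles (y ** (\<tau> ** a)) a"
      by (simp add: matrix_mul_assoc yy)
    moreover have "connected_component invertibles (y ** (\<tau> ** a)) (y ** x)"
      by (intro connected_component_mult x yy)
    ultimately have "connected_component invertibles a (y ** x)"
      by (meson connected_component_sym connected_component_trans)
    moreover have "y ** x \<in> {mat 1, R}" using x y RR by auto
    ultimately show ?thesis by blast
  qed
qed

lemma connected_component_invertibles_det_pos:
  assumes "connected_component invertibles a b" "det a > 0"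
  shows "det b > 0"
proof -
  obtain C where C: "connected C" "C \<subseteq> invertibles" "a \<in> C" "b \<in> C"
    using assms(1) unfolding connected_component_def by blast
  show ?thesis
  proof (rule connected_image_sign[where F = det and S = C])
    show "continuous_on C (\<lambda>x. det x)"
      by (intro continuous_on_det continuous_on_id)
  qed (use C assms(2) in \<open>auto simp: invertibles_def invertible_det_nz\<close>)
qed

lemma card_components_two:
  assumes "x \<in> S" "y \<in> S" "\<not> connected_component S x y"
    "\<And>z. z \<in> S \<Longrightarrow> connected_component S z x \<or> connected_component S z y"
  shows "card (components S) = 2"
proof -
  have "components S = {connected_component_set S x, connected_component_set S y}"
  proof
    show "components S \<subseteq> {connected_component_set S x, connected_component_set S y}"
    proof
      fix C assume "C \<in> components S"
      then obtain z where z: "z \<in> S" "C = connected_component_set S z"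
        unfolding components_def by blast
      then show "C \<in> {connected_component_set S x, connected_component_set S y}"
        using assms(4)[OF z(1)] connected_component_eq[of _ S z] by blast
    qed
  qed (use assms in \<open>auto simp: components_def\<close>)
  moreover have "connected_component_set S x \<noteq> connected_component_set S y"
    using assms by (simp add: connected_component_eq_eq)
  ultimately show ?thesis by simp
qed

lemma card_components_invertibles:
  assumes "CARD('n) \<ge> 2"
  shows "card (components (invertibles :: (real^'n^'n) set)) = 2"
proof (rule card_components_two)
  let ?R = "reflection (axis undefined 1) :: real^'n^'n"
  show "\<not> connected_component invertibles (mat 1) ?R"
    using connected_component_invertibles_det_pos[of "mat 1" ?R] by (auto simp: det_reflection_axis)
  show "connected_component invertibles z (mat 1) \<or> connected_component invertibles z ?R"
    if "z \<in> invertibles" for z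
    using invertible_connected_component_one_or_reflection[OF assms that] by blast
qed (simp_all add: invertibles_def invertible_det_nz det_reflection_axis)

section \<open>The set of square roots of minus one\<close>

lemma intertwine_inverse:
  fixes X b f g :: "real^'n^'n"
  assumes "X ** b = mat 1" "b ** X = mat 1" "f ** X = X ** g"
  shows "b ** f = g ** b"
proof -
  have "b ** f = b ** (f ** X) ** b" by (simp add: assms(1) flip: matrix_mul_assoc)
  also have "\<dots> = g ** b" by (simp add: assms(2,3) matrix_mul_assoc)
  finally show ?thesis .
qed

lemma conjugate_eq:
  fixes a f :: "real^'n^'n"
  assumes "invertible a"
  shows "g = matrix_inv a ** f ** a \<longleftrightarrow> f ** a = a ** g"
proof
  assume "g = matrix_inv a ** f ** a"
  then show "f ** a = a ** g"
    by (simp add: matrix_mul_assoc matrix_inv_mult[OF assms])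
next
  assume "f ** a = a ** g"
  then show "g = matrix_inv a ** f ** a"
    by (simp add: matrix_inv_mult[OF assms] matrix_mul_assoc flip: matrix_mul_assoc[of _ f a])
qed

lemma sqrts_minus_one_eq_conjugacy_class:
  fixes J :: "real^'n^'n"
  assumes J: "J ** J = - mat 1"
  shows "sqrts_minus_one = conjugacy_class J"
proof
  show "sqrts_minus_one \<subseteq> conjugacy_class J"
  proof
    fix f :: "real^'n^'n" assume "f \<in> sqrts_minus_one"
    then obtain a where "invertible a" "J ** a = a ** f"
      using invertible_intertwiner_exists[OF J] by (auto simp: sqrts_minus_one_def)
    then show "f \<in> conjugacy_class J"
      unfolding conjugacy_class_def using conjugate_eq by (auto simp: invertibles_def)
  qed
  show "conjugacy_class J \<subseteq> sqrts_minus_one"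
  proof
    fix f assume "f \<in> conjugacy_class J"
    then obtain a where a: "invertible a" "f = matrix_inv a ** J ** a"
      by (auto simp: conjugacy_class_def invertibles_def)
    have "f ** f = matrix_inv a ** J ** (a ** matrix_inv a) ** J ** a"
      by (simp add: a(2) matrix_mul_assoc)
    also have "\<dots> = matrix_inv a ** (J ** J) ** a"
      by (simp add: matrix_inv_mult[OF a(1)] matrix_mul_assoc)
    also have "\<dots> = - mat 1"
      by (simp add: J mm.minus_left mm.minus_right matrix_inv_mult[OF a(1)])
    finally show "f \<in> sqrts_minus_one" by (simp add: sqrts_minus_one_def)
  qed
qed

text \<open>Both \<open>f\<close> and \<open>- f\<close> are square roots of -1, hence conjugate, so
  the trace equals its own negative.\<close>

lemma trace_sqrt_minus_one:
  fixes f :: "real^'n^'n"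
  assumes f: "f ** f = - mat 1"
  shows "trace f = 0"
proof -
  have "- f ** - f = - mat 1" by (simp add: f mm.minus_left mm.minus_right)
  from invertible_intertwiner_exists[OF f this]
  obtain a where a: "invertible a" "f ** a = a ** - f" by blast
  have "- f = matrix_inv a ** (f ** a)"
    using iffD2[OF conjugate_eq[OF a(1)] a(2)] by (simp only: matrix_mul_assoc)
  then have "trace (- f) = trace f"
    by (metis trace_mul_sym matrix_mul_assoc matrix_inv_mult(1)[OF a(1)] matrix_mul_rid)
  moreover have "trace (- f) = - trace f"
    by (simp add: trace_def sum_negf)
  ultimately show ?thesis by simp
qed

section \<open>Dimension of the model space and the Cayley charts\<close>

lemma dim_anticommuting:
  fixes J :: "real^'n^'n"
  assumes J: "J ** J = - mat 1"
  shows "2 * dim {y. J ** y = - (y ** J)} = CARD('n)\<^sup>2"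
proof -
  define L where "L = {y. J ** y = - (y ** J)}"
  define C where "C = {y. J ** y = y ** J}"
  have sL: "subspace L"
    by (auto simp: L_def subspace_def mm.add_left mm.add_right mm.scaleR_left mm.scaleR_right)
  have sC: "subspace C"
    by (auto simp: C_def subspace_def mm.add_left mm.add_right mm.scaleR_left mm.scaleR_right)
  \<comment> \<open>An intertwiner \<open>h\<close> of \<open>J\<close> and \<open>- J\<close>
    anticommutes with \<open>J\<close>; left multiplication by it is injective and exchanges
    \<open>C\<close> and \<open>L\<close>.\<close>
  have "- J ** - J = - mat 1" by (simp add: J mm.minus_left mm.minus_right)
  from invertible_intertwiner_exists[OF J this]
  obtain h where h: "invertible h" "J ** h = h ** - J" by blast
  have lin: "linear ((**) h)" by (simp add: mm.bounded_linear_right bounded_linear.linear)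
  have "inj ((**) h)"
    by (metis injI h(1) matrix_inv_mult(2) matrix_mul_assoc matrix_mul_lid)
  then have dim_h: "dim ((**) h ` S) = dim S" for S :: "(real^'n^'n) set"
    using lin by (intro dim_image_eq) (auto intro: inj_on_subset)
  have Jh: "J ** (h ** y) = - (h ** (J ** y))" for y :: "real^'n^'n"
    by (simp add: matrix_mul_assoc h mm.minus_left mm.minus_right)
  have "(**) h ` C \<subseteq> L" "(**) h ` L \<subseteq> C"
    by (auto simp: L_def C_def Jh mm.minus_right simp flip: matrix_mul_assoc)
  then have "dim C = dim L"
    using dim_subset[of "(**) h ` C" L] dim_subset[of "(**) h ` L" C] by (simp add: dim_h)
  have JJx: "J ** (J ** x) = - x" for x :: "real^'n^'n"
    by (simp add: matrix_mul_assoc J mm.minus_left)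
  have "C \<inter> L = {0}"
  proof -
    have "y = 0" if "y \<in> C" "y \<in> L" for y
    proof -
      have "J ** y = 0" using that by (simp add: C_def L_def vec_eq_iff)
      then show ?thesis using JJx[of y] by (simp add: mm.zero_right)
    qed
    then show ?thesis by (auto simp: C_def L_def mm.zero_left mm.zero_right)
  qed
  moreover have "{x + y |x y. x \<in> C \<and> y \<in> L} = UNIV"
  proof -
    have "z \<in> {x + y |x y. x \<in> C \<and> y \<in> L}" for z
    proof -
      \<comment> \<open>These are the projections onto the eigenspaces \<open>C\<close> and
        \<open>L\<close>, for the eigenvalues 1 and -1, of the involution
        \<open>z \<mapsto> - (J ** z ** J)\<close>.\<close>
      have "z = (1/2) *\<^sub>R (z - J ** z ** J) + (1/2) *\<^sub>R (z + J ** z ** J)"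
        by (simp add: scaleR_diff_right scaleR_add_right flip: scaleR_add_left)
      moreover have "(1/2) *\<^sub>R (z - J ** z ** J) \<in> C"
        by (intro subspace_scale sC) (simp add: C_def mm.diff_left mm.diff_right J JJx mm.minus_right flip: matrix_mul_assoc)
      moreover have "(1/2) *\<^sub>R (z + J ** z ** J) \<in> L"
        by (intro subspace_scale sL) (simp add: L_def mm.add_left mm.add_right J JJx mm.minus_right flip: matrix_mul_assoc)
      ultimately show ?thesis by blast
    qed
    then show ?thesis by blast
  qed
  ultimately have "DIM(real^'n^'n) = dim C + dim L"
    using dim_sums_Int[OF sC sL] by simp
  then show ?thesis using \<open>dim C = dim L\<close> by (simp add: L_def power2_eq_square)
qed

lemma matrix_two_invertible_times:
  assumes "invertible (J :: real^'n^'n)"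
  shows "invertible (J + J)"
proof -
  have "(J + J) ** ((1/2) *\<^sub>R matrix_inv J) = mat 1"
    unfolding scaleR_2[symmetric] by (simp add: mm.scaleR_left mm.scaleR_right matrix_inv_mult[OF assms])
  then show ?thesis by (auto simp: invertible_right_inverse)
qed

lemma submanifold_sqrts_minus_one:
  assumes "CARD('n::finite) = 2 * d"
  shows "submanifold (2 * d\<^sup>2) (sqrts_minus_one :: (real^'n^'n) set)"
  unfolding submanifold_def
proof (intro ballI exI conjI)
  fix J :: "real^'n^'n" assume "J \<in> sqrts_minus_one"
  then have J: "J ** J = - mat 1" by (simp add: sqrts_minus_one_def)
  have JJx: "J ** (J ** x) = - x" for x :: "real^'n^'n"
    by (simp add: matrix_mul_assoc J mm.minus_left)
  have "J ** - J = mat 1" by (simp add: J mm.minus_right)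
  then have Jinv: "invertible J" by (auto simp: invertible_right_inverse)
  \<comment> \<open>The scalars 1 and -1 are spelled out so that both domains have the form used in
    \<open>C_k_on_matrix_inv_affine\<close>.\<close>
  define U where "U = {g. invertible (1 *\<^sub>R g + J)}"
  define V where "V = {y :: real^'n^'n. invertible ((-1) *\<^sub>R y + mat 1)}"
  \<comment> \<open>The Cayley transform \<open>\<phi> g = (g + J)\<^sup>-\<^sup>1 (g - J)\<close> and its inverse
    \<open>\<psi> y = J (1 + y) (1 - y)\<^sup>-\<^sup>1\<close>, rewritten so that the variable occurs only in the inverse.\<close>
  define \<phi> where "\<phi> g = mat 1 + matrix_inv (1 *\<^sub>R g + J) ** (- (J + J))" for g
  define \<psi> where "\<psi> y = - J + (J + J) ** matrix_inv ((-1) *\<^sub>R y + mat 1)" for y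
  define L where "L = {y. J ** y = - (y ** J)}"
  show oU: "open U" unfolding U_def by (intro open_invertible_preimage continuous_intros)
  show oV: "open V" unfolding V_def by (intro open_invertible_preimage continuous_intros)
  show "J \<in> U" using matrix_two_invertible_times[OF Jinv] by (simp add: U_def)
  show smooth: "smooth_on \<phi> U" unfolding smooth_on_def \<phi>_def U_def
    by (intro allI C_k_on_add C_k_on_matrix_mult C_k_on_const C_k_on_matrix_inv_affine oU[unfolded U_def])
  show smooth': "smooth_on \<psi> V" unfolding smooth_on_def \<psi>_def V_def
    by (intro allI C_k_on_add C_k_on_matrix_mult C_k_on_const C_k_on_matrix_inv_affine oV[unfolded V_def])
  have \<phi>V: "\<phi> g \<in> V \<and> \<psi> (\<phi> g) = g" if "g \<in> U" for g
  proof -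
    have i: "invertible (g + J)" using that by (simp add: U_def)
    have one: "(-1) *\<^sub>R \<phi> g + mat 1 = matrix_inv (g + J) ** (J + J)"
      by (simp add: \<phi>_def mm.minus_right)
    \<comment> \<open>The explicit inverse of \<open>J + J\<close> yields that of
      \<open>matrix_inv (g + J) ** (J + J)\<close>, so \<open>\<psi> (\<phi> g)\<close> can be
      computed.\<close>
    have inv2: "(J + J) ** ((-1/2) *\<^sub>R J) = mat 1"
      unfolding scaleR_2[symmetric] by (simp add: mm.scaleR_left mm.scaleR_right mm.minus_right J)
    have "matrix_inv (g + J) ** (J + J) ** ((-1/2) *\<^sub>R J ** (g + J)) = mat 1"
      using inv2 by (metis i matrix_inv_mult(2) matrix_mul_assoc matrix_mul_rid)
    then have "matrix_inv (matrix_inv (g + J) ** (J + J)) = (-1/2) *\<^sub>R J ** (g + J)"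
      "invertible (matrix_inv (g + J) ** (J + J))"
      by (auto simp: matrix_inv_unique invertible_right_inverse)
    then have "\<phi> g \<in> V" "\<psi> (\<phi> g) = - J + (J + J) ** ((-1/2) *\<^sub>R J ** (g + J))"
      by (simp_all only: V_def \<psi>_def one mem_Collect_eq)
    moreover have "(J + J) ** ((-1/2) *\<^sub>R J ** (g + J)) = g + J"
      by (simp only: matrix_mul_assoc inv2 matrix_mul_lid)
    ultimately show ?thesis by simp
  qed
  have \<psi>U: "\<psi> y \<in> U \<and> \<phi> (\<psi> y) = y" if "y \<in> V" for y
  proof -
    have i: "invertible (mat 1 - y)" using that by (simp add: V_def)
    have one: "1 *\<^sub>R \<psi> y + J = (J + J) ** matrix_inv (mat 1 - y)"
      by (simp add: \<psi>_def)
    have inv2: "((-1/2) *\<^sub>R J) ** (J + J) = mat 1" "(J + J) ** ((-1/2) *\<^sub>R J) = mat 1"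
      unfolding scaleR_2[symmetric]
      by (simp_all add: mm.scaleR_left mm.scaleR_right mm.minus_left mm.minus_right J)
    have "(J + J) ** matrix_inv (mat 1 - y) ** ((mat 1 - y) ** ((-1/2) *\<^sub>R J)) = mat 1"
      using inv2(2) by (metis i matrix_inv_mult(2) matrix_mul_assoc matrix_mul_rid)
    then have "matrix_inv ((J + J) ** matrix_inv (mat 1 - y)) = (mat 1 - y) ** ((-1/2) *\<^sub>R J)"
      "invertible ((J + J) ** matrix_inv (mat 1 - y))"
      by (auto simp: matrix_inv_unique invertible_right_inverse)
    then have "\<psi> y \<in> U" "\<phi> (\<psi> y) = mat 1 + (mat 1 - y) ** ((-1/2) *\<^sub>R J) ** (- (J + J))"
      by (simp_all only: U_def \<phi>_def one mem_Collect_eq)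
    moreover have "(mat 1 - y) ** ((-1/2) *\<^sub>R J) ** (- (J + J)) = - (mat 1 - y)"
      using inv2(1) by (simp only: mm.minus_right flip: matrix_mul_assoc) simp
    ultimately show ?thesis by simp
  qed
  have cont: "continuous_on U \<phi>" "continuous_on V \<psi>"
    using smooth smooth' unfolding smooth_on_def by (metis C_k_on.simps(1))+
  show "homeomorphism U V \<phi> \<psi>"
    by (rule homeomorphismI) (use cont \<phi>V \<psi>U in auto)
  show "subspace L"
    by (auto simp: L_def subspace_def mm.add_left mm.add_right mm.scaleR_left mm.scaleR_right)
  show "dim L = 2 * d\<^sup>2"
    using dim_anticommuting[OF J] assms by (simp add: L_def power2_eq_square)
  have \<phi>L: "\<phi> g \<in> L" if g: "g \<in> U" "g ** g = - mat 1" for g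
  proof -
    define b where "b = matrix_inv (g + J)"
    have i: "invertible (g + J)" using g by (simp add: U_def)
    have b: "b ** (g + J) = mat 1" "(g + J) ** b = mat 1"
      by (simp_all add: b_def matrix_inv_mult[OF i])
    \<comment> \<open>Having the same square, \<open>g\<close> and \<open>J\<close> are intertwined
      by \<open>g + J\<close> in both directions, and so by its inverse \<open>b\<close>.\<close>
    have "J ** (g + J) = (g + J) ** g"
      by (simp add: mm.add_left mm.add_right J g)
    then have bJ: "b ** J = g ** b"
      by (rule intertwine_inverse[OF b(2,1)])
    have "g ** (g + J) = (g + J) ** J"
      by (simp add: mm.add_left mm.add_right J g)
    then have bg: "b ** g = J ** b"
      by (rule intertwine_inverse[OF b(2,1)])
    have e: "\<phi> g = mat 1 - 2 *\<^sub>R (b ** J)"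
      unfolding \<phi>_def b_def scaleR_2[of J, symmetric] by (simp add: mm.scaleR_right mm.minus_right)
    have "J ** \<phi> g + \<phi> g ** J = (J + J) - 2 *\<^sub>R (J ** b ** J + b ** J ** J)"
      by (simp add: e mm.diff_left mm.diff_right mm.scaleR_left mm.scaleR_right matrix_mul_assoc scaleR_add_right)
    also have "J ** b ** J + b ** J ** J = b ** (g + J) ** J"
      by (simp add: mm.add_left mm.add_right bg)
    also have "\<dots> = J" by (simp add: b)
    finally have "J ** \<phi> g + \<phi> g ** J = 0" by (simp add: scaleR_2)
    then show ?thesis by (simp add: L_def eq_neg_iff_add_eq_0)
  qed
  have \<psi>S: "\<psi> y ** \<psi> y = - mat 1" if y: "y \<in> V" "y \<in> L" for y
  proof -
    define b where "b = matrix_inv (mat 1 - y)"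
    have i: "invertible (mat 1 - y)" using y by (simp add: V_def)
    have b: "b ** (mat 1 - y) = mat 1" "(mat 1 - y) ** b = mat 1"
      by (simp_all add: b_def matrix_inv_mult[OF i])
    \<comment> \<open>This restores the form \<open>J ** ((mat 1 + y) ** b)\<close> of
      \<open>\<psi> y\<close>, in which the factors of its square can be moved past each
      other.\<close>
    have "mat 1 + y = 2 *\<^sub>R mat 1 - (mat 1 - y)" by (simp add: scaleR_2)
    then have "(mat 1 + y) ** b = (2 *\<^sub>R mat 1) ** b - (mat 1 - y) ** b"
      by (simp only: mm.diff_left[of "2 *\<^sub>R mat 1"])
    then have "(mat 1 + y) ** b = 2 *\<^sub>R b - mat 1"
      by (simp only: b mm.scaleR_left matrix_mul_lid)
    moreover have "\<psi> y = - J + 2 *\<^sub>R J ** b"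
      unfolding \<psi>_def b_def scaleR_2 by simp
    ultimately have \<psi>: "\<psi> y = J ** ((mat 1 + y) ** b)"
      by (simp only: mm.diff_right mm.scaleR_right mm.scaleR_left) simp
    \<comment> \<open>Moving \<open>J\<close> across flips the sign of \<open>y\<close>, so each
      factor \<open>mat 1 + y\<close> becomes \<open>mat 1 - y\<close> and cancels against
      \<open>b\<close>.\<close>
    have yJ: "(mat 1 + y) ** J = J ** (mat 1 - y)"
      using y(2) by (simp add: L_def mm.add_left mm.diff_right)
    have "J ** (mat 1 + y) = (mat 1 - y) ** J"
      using y(2) by (simp add: L_def mm.add_right mm.diff_left)
    then have bJ: "b ** J ** (mat 1 + y) = J"
      by (simp add: matrix_mul_assoc b flip: matrix_mul_assoc[of b J])
    have "\<psi> y ** \<psi> y = J ** (mat 1 + y) ** (b ** J ** (mat 1 + y)) ** b"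
      by (simp add: \<psi> matrix_mul_assoc)
    also have "\<dots> = J ** ((mat 1 + y) ** J) ** b"
      by (simp only: bJ matrix_mul_assoc)
    also have "\<dots> = J ** J ** ((mat 1 - y) ** b)"
      by (simp only: yJ matrix_mul_assoc)
    also have "\<dots> = - mat 1" by (simp add: b J)
    finally show ?thesis .
  qed
  show "\<phi> ` (U \<inter> sqrts_minus_one) = V \<inter> L"
  proof
    show "\<phi> ` (U \<inter> sqrts_minus_one) \<subseteq> V \<inter> L"
      using \<phi>V \<phi>L by (auto simp: sqrts_minus_one_def)
    show "V \<inter> L \<subseteq> \<phi> ` (U \<inter> sqrts_minus_one)"
    proof
      fix y assume "y \<in> V \<inter> L"
      then have "y = \<phi> (\<psi> y)" "\<psi> y \<in> U \<inter> sqrts_minus_one"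
        using \<psi>U \<psi>S by (auto simp: sqrts_minus_one_def)
      then show "y \<in> \<phi> ` (U \<inter> sqrts_minus_one)" by (rule image_eqI)
    qed
  qed
qed

section \<open>Connected components of the set of square roots\<close>

lemma connected_component_sqrts_minus_one_det_pos:
  fixes J R :: "real^'n^'n"
  assumes J: "J ** J = - mat 1" and g: "connected_component sqrts_minus_one J g"
    and R: "invertible R" "J ** R = R ** g"
  shows "det R > 0"
proof (rule ccontr)
  assume "\<not> det R > 0"
  then have R_neg: "det R < 0" using R(1) by (simp add: invertible_det_nz)
  \<comment> \<open>The predicate \<open>P\<close> lets both signs be treated at once. The two sets
    so obtained separate the square roots, so a connected set containing \<open>J\<close> and
    \<open>g\<close> cannot meet both.\<close>
  define S where "S P = {f. \<exists>a :: real^'n^'n. P (det a) \<and> J ** a = a ** f}" for P :: "real \<Rightarrow> bool"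
  \<comment> \<open>For \<open>g\<close> near \<open>f\<close>, the intertwiner \<open>1 - f g\<close> from \<open>f\<close> to \<open>g\<close> is close to \<open>2\<close>, so the sign
    of the determinant of an intertwiner from \<open>J\<close> is locally constant.\<close>
  define N where "N f = {g. det (mat 1 - f ** g) > 0}" for f :: "real^'n^'n"
  have oN: "open (N f)" for f
    unfolding N_def by (intro open_Collect_less continuous_intros continuous_on_det mm.continuous_on)
  have self: "f \<in> N f" if "f ** f = - mat 1" for f
  proof -
    have "mat 1 + mat 1 = (2::real) *\<^sub>R (mat 1 :: real^'n^'n)" by (simp add: scaleR_2)
    moreover have "det (2 *\<^sub>R (mat 1 :: real^'n^'n)) = 2 ^ CARD('n)"
      by (simp add: det_diagonal mat_def if_distrib cong: if_cong)
    ultimately show ?thesis using that by (simp add: N_def)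
  qed
  have transfer: "g \<in> S P" if "f \<in> S P" "g \<in> N f" "f ** f = - mat 1" "g ** g = - mat 1"
    and P: "\<And>x y. P x \<Longrightarrow> y > 0 \<Longrightarrow> P (x * y)" for f g and P :: "real \<Rightarrow> bool"
  proof -
    have "\<exists>a. P (det a) \<and> J ** a = a ** f" using that(1) unfolding S_def by blast
    then obtain a where a: "P (det a)" "J ** a = a ** f" by blast
    have "f ** (mat 1 - f ** g) = (mat 1 - f ** g) ** g"
      using that by (simp add: mm.diff_left mm.diff_right matrix_mul_assoc mm.minus_left)
        (simp add: mm.minus_right flip: matrix_mul_assoc)
    then have "a ** (f ** (mat 1 - f ** g)) = (a ** (mat 1 - f ** g)) ** g"
      by (simp only: matrix_mul_assoc)
    then have "J ** (a ** (mat 1 - f ** g)) = (a ** (mat 1 - f ** g)) ** g"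
      by (simp only: matrix_mul_assoc a(2))
    moreover have "P (det (a ** (mat 1 - f ** g)))"
      using P[OF a(1)] that(2) by (simp add: det_mul N_def)
    ultimately show ?thesis unfolding S_def by blast
  qed
  \<comment> \<open>An open set of the ambient space which, for \<open>P\<close> stable under
    positive factors, cuts out of the square roots exactly those in \<open>S P\<close>.\<close>
  define Q where "Q P = (\<Union>f\<in>S P \<inter> sqrts_minus_one. N f)" for P
  have Qsub: "Q P \<inter> sqrts_minus_one \<subseteq> S P" if "\<And>x y. P x \<Longrightarrow> y > 0 \<Longrightarrow> P (x * y)" for P
  proof
    fix g assume "g \<in> Q P \<inter> sqrts_minus_one"
    then obtain f where "f \<in> S P" "g \<in> N f" "f ** f = - mat 1" "g ** g = - mat 1"
      by (auto simp: Q_def sqrts_minus_one_def)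
    then show "g \<in> S P" using that by (rule transfer)
  qed
  obtain T where T: "connected T" "T \<subseteq> sqrts_minus_one" "J \<in> T" "g \<in> T"
    using g unfolding connected_component_def by blast
  have pos: "Q (\<lambda>x. x > 0) \<inter> sqrts_minus_one \<subseteq> S (\<lambda>x. x > 0)"
    and neg: "Q (\<lambda>x. x < 0) \<inter> sqrts_minus_one \<subseteq> S (\<lambda>x. x < 0)"
    by (rule Qsub, simp add: mult_neg_pos)+
  have disj: "S (\<lambda>x. x > 0) \<inter> S (\<lambda>x. x < 0) = {}"
  proof -
    have False if a: "det a > 0" "J ** a = a ** f" and b: "det b < 0" "J ** b = b ** f" for a b f
    proof -
      have ib: "invertible b" "invertible a" using a b by (auto simp: invertible_det_nz)
      \<comment> \<open>Two intertwiners from \<open>J\<close> to the same \<open>f\<close> differ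
        by a matrix commuting with \<open>J\<close>; its determinant is positive, so their signs
        agree.\<close>
      define c where "c = a ** matrix_inv b"
      have cb: "c ** b = a" by (simp add: c_def matrix_inv_mult[OF ib(1)] flip: matrix_mul_assoc)
      have "f ** matrix_inv b = matrix_inv b ** J"
        using intertwine_inverse[OF matrix_inv_mult[OF ib(1)] b(2)] by simp
      then have "a ** (f ** matrix_inv b) = c ** J"
        by (simp only: c_def matrix_mul_assoc)
      then have "J ** c = c ** J"
        by (simp only: c_def matrix_mul_assoc a(2))
      moreover have "det a = det c * det b" by (simp flip: cb add: det_mul)
      moreover from this have "invertible c" using a by (auto simp: invertible_det_nz)
      ultimately show False
        using det_pos_of_commute_sqrt_minus_one[OF J, of c] a b by (simp add: zero_less_mult_iff)
    qed
    then show ?thesis unfolding S_def by blast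
  qed
  have cover: "sqrts_minus_one \<subseteq> Q (\<lambda>x. x > 0) \<union> Q (\<lambda>x. x < 0)"
  proof
    fix f :: "real^'n^'n" assume f: "f \<in> sqrts_minus_one"
    then obtain a where "invertible a" "J ** a = a ** f"
      using invertible_intertwiner_exists[OF J] by (auto simp: sqrts_minus_one_def)
    then have "f \<in> S (\<lambda>x. x > 0) \<union> S (\<lambda>x. x < 0)"
      unfolding S_def using linorder_neqE[of "det a" 0] by (auto simp: invertible_det_nz)
    then show "f \<in> Q (\<lambda>x. x > 0) \<union> Q (\<lambda>x. x < 0)"
      using f self by (auto simp: Q_def sqrts_minus_one_def)
  qed
  have "J \<in> S (\<lambda>x. x > 0)" unfolding S_def by (auto intro: exI[of _ "mat 1"])
  moreover have "g \<in> S (\<lambda>x. x < 0)" unfolding S_def using R R_neg by auto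
  ultimately have "Q (\<lambda>x. x > 0) \<inter> T \<noteq> {}" "Q (\<lambda>x. x < 0) \<inter> T \<noteq> {}"
    using T self by (auto simp: Q_def sqrts_minus_one_def)
  moreover have "open (Q (\<lambda>x. x > 0))" "open (Q (\<lambda>x. x < 0))"
    unfolding Q_def by (intro open_UN ballI oN)+
  moreover have "Q (\<lambda>x. x > 0) \<inter> Q (\<lambda>x. x < 0) \<inter> T = {}"
    using pos neg disj T(2) by blast
  ultimately show False
    using connectedD[OF T(1)] subset_trans[OF T(2) cover] by blast
qed

text \<open>The orbit map \<open>\<pi>\<close> is continuous, so the two components of the group
  give at most two here, those of \<open>J\<close> and \<open>\<pi> ?R\<close>. They differ because
  \<open>?R\<close> intertwines these two points and has determinant -1.\<close>

lemma card_components_sqrts_minus_one: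
  assumes "CARD('n::finite) = 2 * d" "d \<ge> 1"
  shows "card (components (sqrts_minus_one :: (real^'n^'n) set)) = 2"
proof -
  obtain J :: "real^'n^'n" where J: "J ** J = - mat 1"
    using exists_sqrt_minus_one[OF assms(1)] by blast
  let ?R = "reflection (axis undefined 1) :: real^'n^'n"
  define \<pi> where "\<pi> a = matrix_inv a ** J ** a" for a :: "real^'n^'n"
  have S: "sqrts_minus_one = \<pi> ` invertibles"
    unfolding sqrts_minus_one_eq_conjugacy_class[OF J] conjugacy_class_def \<pi>_def by auto
  have cont: "continuous_on invertibles \<pi>"
    unfolding \<pi>_def invertibles_def
    by (intro mm.continuous_on continuous_on_matrix_inv continuous_intros)
  have cc: "connected_component sqrts_minus_one (\<pi> a) (\<pi> b)"
    if "connected_component invertibles a b" for a b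
    by (rule connected_component_image[OF that cont]) (simp add: S)
  have one: "\<pi> (mat 1) = J" by (simp add: \<pi>_def matrix_inv_unique[of "mat 1" "mat 1"])
  have iR: "invertible ?R" by (simp add: invertible_det_nz det_reflection_axis)
  have n: "CARD('n) \<ge> 2" using assms by simp
  show ?thesis
  proof (rule card_components_two)
    show "J \<in> sqrts_minus_one" using J by (simp add: sqrts_minus_one_def)
    show "\<pi> ?R \<in> sqrts_minus_one" using iR by (simp add: S invertibles_def)
    show "\<not> connected_component sqrts_minus_one J (\<pi> ?R)"
      using connected_component_sqrts_minus_one_det_pos[OF J _ iR, of "\<pi> ?R"]
        conjugate_eq[OF iR, of "\<pi> ?R" J] by (auto simp: \<pi>_def det_reflection_axis)
    show "connected_component sqrts_minus_one f J \<or> connected_component sqrts_minus_one f (\<pi> ?R)"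
      if f: "f \<in> sqrts_minus_one" for f
    proof -
      obtain a where a: "a \<in> invertibles" "f = \<pi> a" using f S by blast
      show ?thesis
        using invertible_connected_component_one_or_reflection[OF n a(1)] cc a(2) one by auto
    qed
  qed
qed

section \<open>The hyperplane and the assembly of the theorem\<close>

lemma trace_eq_inner: "trace (f :: real^'n^'n) = mat 1 \<bullet> f"
  by (simp add: trace_def inner_vec_def mat_def if_distrib[of "\<lambda>x. x * _"] cong: if_cong)

text \<open>Exhibits \<open>mat 1\<close> as a normal vector of the kernel of \<open>Scal\<close>,
  so that the general facts on hyperplanes give its dimension.\<close>

lemma Scal_eq_0_iff: "Scal (f :: real^'n^'n) = 0 \<longleftrightarrow> mat 1 \<bullet> f = 0"
  using trace_eq_Scal[of f] by (simp add: trace_eq_inner)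

theorem mainTheorem1:
  fixes d :: nat
  assumes "d \<ge> 1"
    and "CARD('n::finite) = 2 * d"
  shows "(\<exists>f. (sqrts_minus_one :: (real^'n^'n) set) = conjugacy_class f)
    \<and> submanifold (2 * d\<^sup>2) (sqrts_minus_one :: (real^'n^'n) set)
    \<and> real (2 * d\<^sup>2) = real DIM(real^'n^'n) / 2
    \<and> card (components (sqrts_minus_one :: (real^'n^'n) set)) = 2
    \<and> card (components (invertibles :: (real^'n^'n) set)) = 2
    \<and> subspace {f :: real^'n^'n. Scal f = 0}
    \<and> dim {f :: real^'n^'n. Scal f = 0} = DIM(real^'n^'n) - 1
    \<and> (sqrts_minus_one :: (real^'n^'n) set) \<subseteq> {f. Scal f = 0}"
proof (intro conjI)
  show "\<exists>f. (sqrts_minus_one :: (real^'n^'n) set) = conjugacy_class f"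
    using exists_sqrt_minus_one[OF assms(2)] sqrts_minus_one_eq_conjugacy_class by blast
  show "submanifold (2 * d\<^sup>2) (sqrts_minus_one :: (real^'n^'n) set)"
    by (rule submanifold_sqrts_minus_one[OF assms(2)])
  show "real (2 * d\<^sup>2) = real DIM(real^'n^'n) / 2"
    using assms(2) by (simp add: power2_eq_square)
  show "card (components (sqrts_minus_one :: (real^'n^'n) set)) = 2"
    by (rule card_components_sqrts_minus_one[OF assms(2,1)])
  show "card (components (invertibles :: (real^'n^'n) set)) = 2"
    using assms by (intro card_components_invertibles) simp
  show "subspace {f :: real^'n^'n. Scal f = 0}"
    unfolding Scal_eq_0_iff by (rule subspace_hyperplane)
  show "dim {f :: real^'n^'n. Scal f = 0} = DIM(real^'n^'n) - 1"
  proof -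
    have "(mat 1 :: real^'n^'n) \<noteq> 0" 
      using trace_eq_inner[of "mat 1 :: real^'n^'n"] by (auto simp: trace_I)
    then show ?thesis unfolding Scal_eq_0_iff by (rule dim_hyperplane)
  qed
  show "(sqrts_minus_one :: (real^'n^'n) set) \<subseteq> {f. Scal f = 0}"
    using trace_sqrt_minus_one by (auto simp: sqrts_minus_one_def Scal_eq_0_iff trace_eq_inner)
qed

end
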